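(* Let $\mathcal C_1$ and $\mathcal C_2$ be $C^2$ closed convex curves that intersect in three or more points. Then there are points $P$ on $\mathcal C_1$ and $Q$ on $\mathcal C_2$ with $\kappa_{\mathcal C_1}(P)=\kappa_{\mathcal C_2}(Q)$.
   Context: Curves are of class $C^2$ with nonvanishing first and second derivative vectors, oriented so that the curvature is positive; $\kappa_{\mathcal C}$ denotes the curvature of the curve $\mathcal C$. *)

theory Defs
  imports "HOL-Analysis.Analysis"
begin

text \<open>Plane curves are maps real => complex (the plane identified with C).
  A closed curve is given by a periodic parametrization with period L > 0,
  injective on one period (simple closed curve).\<close>

definition vel :: "(real \<Rightarrow> complex) \<Rightarrow> real \<Rightarrow> complex" where
  "vel \<gamma> t = vector_derivative \<gamma> (at t)"

definition acc :: "(real \<Rightarrow> complex) \<Rightarrow> real \<Rightarrow> complex" where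
  "acc \<gamma> t = vector_derivative (vel \<gamma>) (at t)"

text \<open>Signed curvature (x'y'' - y'x'') / |gamma'|^3.\<close>
definition curvature :: "(real \<Rightarrow> complex) \<Rightarrow> real \<Rightarrow> real" where
  "curvature \<gamma> t = Im (cnj (vel \<gamma> t) * acc \<gamma> t) / norm (vel \<gamma> t) ^ 3"

definition C2_regular :: "(real \<Rightarrow> complex) \<Rightarrow> bool" where
  "C2_regular \<gamma> \<longleftrightarrow>
     (\<forall>t. \<gamma> differentiable at t) \<and> (\<forall>t. vel \<gamma> differentiable at t) \<and>
     continuous_on UNIV (acc \<gamma>) \<and>
     (\<forall>t. vel \<gamma> t \<noteq> 0) \<and> (\<forall>t. acc \<gamma> t \<noteq> 0)"

definition simple_closed :: "(real \<Rightarrow> complex) \<Rightarrow> real \<Rightarrow> bool" where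
  "simple_closed \<gamma> L \<longleftrightarrow> L > 0 \<and> (\<forall>t. \<gamma> (t + L) = \<gamma> t) \<and> inj_on \<gamma> {0..<L}"

definition convex_curve :: "(real \<Rightarrow> complex) \<Rightarrow> real \<Rightarrow> bool" where
  "convex_curve \<gamma> L \<longleftrightarrow>
     (\<exists>K. compact K \<and> convex K \<and> interior K \<noteq> {} \<and> frontier K = \<gamma> ` {0..L})"

text \<open>The standing conventions: C^2, regular, nonvanishing second derivative,
  closed, simple, convex, oriented with positive curvature.\<close>
definition closed_convex_C2_curve :: "(real \<Rightarrow> complex) \<Rightarrow> real \<Rightarrow> bool" where
  "closed_convex_C2_curve \<gamma> L \<longleftrightarrow>
     C2_regular \<gamma> \<and> simple_closed \<gamma> L \<and> convex_curve \<gamma> L \<and> (\<forall>t. curvature \<gamma> t > 0)"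

end

theory Submission
  imports Defs
begin

text \<open>
  It suffices to show that a closed convex curve through three points of a circle of radius \<open>R\<close>
  has curvature \<open>1 / R\<close> somewhere: applied to both curves and the circumcircle of three common
  points, this gives the common value.

  If the curvature avoids \<open>1 / R\<close>, it is everywhere larger or everywhere smaller. By Blaschke's
  rolling theorem the curve then lies inside, respectively outside, each disc of radius \<open>R\<close> that
  touches it from its inner side. Take the one of the three points that is opposite to the longest
  of the three circle arcs between them; no direction of the normal there is compatible with the
  position of the other two points relative to the touching disc.

  Rolling theorem: let \<open>T\<close> and \<open>N\<close> be the unit tangent and the inner normal. For fixed \<open>t\<close>, the
  function \<open>s \<mapsto> inner (\<gamma> s - \<gamma> t) (N t) + R * inner (T s) (T t)\<close> measures the position of the
  centre \<open>\<gamma> s + R N(s)\<close> relative to the tangent line at \<open>t\<close>. Its derivative is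
  \<open>(1 - R \<kappa>(s)) |\<gamma>'(s)| inner (T s) (N t)\<close>, so its extrema are attained where \<open>T s = \<plusminus> T t\<close>, and
  the sign of \<open>1 - R \<kappa>\<close> decides which is which.
\<close>

section \<open>Critical points and periodic functions on the real line\<close>

text \<open>A second derivative test for \<open>f' = k * g\<close> in which only \<open>g\<close> is
  differentiated: right of \<open>s\<close>, \<open>g\<close> and hence \<open>f'\<close> is
  negative. In the rolling argument \<open>k\<close> contains the curvature, which is merely
  continuous.\<close>

lemma decrease_right_of_critical_point:
  fixes f g k :: "real \<Rightarrow> real"
  assumes der: "\<And>x. (f has_real_derivative k x * g x) (at x)"
    and k: "\<And>x. k x > 0"
    and g: "g s = 0" "(g has_real_derivative D) (at s)" "D < 0"
  shows "\<exists>x. f x < f s"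
proof -
  obtain d where d: "d > 0" "\<And>h. 0 < h \<Longrightarrow> h < d \<Longrightarrow> g (s + h) < g s"
    using DERIV_neg_dec_right[OF g(2,3)] by auto
  have "\<exists>z. s < z \<and> z < s + d/2 \<and> f (s + d/2) - f s = (s + d/2 - s) * (k z * g z)"
    by (rule MVT2) (use d der in auto)
  then obtain z where z: "s < z" "z < s + d/2" "f (s + d/2) - f s = d/2 * (k z * g z)"
    by auto
  have "g z < 0" using d(2)[of "z - s"] z d(1) g(1) by auto
  then have "d/2 * (k z * g z) < 0"
    using k[of z] d(1) by (simp add: mult_pos_neg)
  then have "f (s + d/2) < f s" using z(3) by linarith
  then show ?thesis ..
qed

lemma periodic_reduce:
  fixes f :: "real \<Rightarrow> 'a"
  assumes "L > 0" "\<And>t. f (t + L) = f t"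
  obtains u where "u \<in> {0..L}" "f u = f t"
proof -
  have per: "f (t + of_int n * L) = f t" for t n
  proof (induction n arbitrary: t rule: int_induct[where k = 0])
    case (step1 i)
    show ?case using step1(2)[of "t + L"] assms(2)[of t] by (simp add: algebra_simps)
  next
    case (step2 i)
    show ?case using step2(2)[of "t - L"] assms(2)[of "t - L"] by (simp add: algebra_simps)
  qed simp
  define u where "u = t + of_int (- \<lfloor>t / L\<rfloor>) * L"
  have "of_int \<lfloor>t / L\<rfloor> \<le> t / L" "t / L < of_int \<lfloor>t / L\<rfloor> + 1" by linarith+
  then have "of_int \<lfloor>t / L\<rfloor> * L \<le> t" "t < (of_int \<lfloor>t / L\<rfloor> + 1) * L"
    using assms(1) pos_le_divide_eq pos_divide_less_eq by blast+
  then have "u \<in> {0..L}" by (auto simp: u_def algebra_simps)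
  moreover have "f u = f t" unfolding u_def by (rule per)
  ultimately show ?thesis using that by blast
qed

lemma periodic_continuous_attains_min:
  fixes f :: "real \<Rightarrow> real"
  assumes "continuous_on UNIV f" "L > 0" "\<And>t. f (t + L) = f t"
  obtains s where "\<And>t. f s \<le> f t"
proof -
  have "\<exists>x\<in>{0..L}. \<forall>y\<in>{0..L}. f x \<le> f y"
    using assms by (intro continuous_attains_inf) (auto intro: continuous_on_subset)
  then obtain s where s: "\<And>t. t \<in> {0..L} \<Longrightarrow> f s \<le> f t" by blast
  have "f s \<le> f t" for t
    using periodic_reduce[of L f t] assms(2,3) s by metis
  then show ?thesis using that by blast
qed

lemma has_vector_derivative_periodic:
  fixes f :: "real \<Rightarrow> 'a::real_normed_vector"
  assumes "\<And>t. f (t + L) = f t" "(f has_vector_derivative D) (at (t + L))"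
  shows "(f has_vector_derivative D) (at t)"
proof -
  have "((\<lambda>x. x + L) has_vector_derivative 1) (at t)"
    by (simp add: has_vector_derivative_add_const flip: has_real_derivative_iff_has_vector_derivative)
  from vector_diff_chain_at[OF this assms(2)] show ?thesis
    by (simp add: o_def assms(1))
qed

lemma has_real_derivative_inner_left:
  fixes f :: "real \<Rightarrow> 'a::real_inner"
  assumes "(f has_vector_derivative D) (at t)"
  shows "((\<lambda>x. inner (f x) a) has_real_derivative inner D a) (at t)"
  using bounded_linear.has_vector_derivative[OF bounded_linear_inner_left assms]
  by (simp add: has_real_derivative_iff_has_vector_derivative)

section \<open>Trigonometry of a tilted normal\<close>

text \<open>Let \<tau> be the angle from the radius at a point of the unit circle to the outer
  normal of the curve there. The left side is positive exactly when the circle point at angle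
  \<alpha> from it lies strictly inside the unit disc touching the curve there; the product makes
  this sign readable.\<close>

lemma cos_diff_half_angle:
  fixes \<alpha> \<tau> :: real
  shows "cos \<tau> - cos (\<tau> - \<alpha>) - (1 - cos \<alpha>) = - 4 * cos ((\<tau> - \<alpha>) / 2) * sin (\<tau> / 2) * sin (\<alpha> / 2)"
proof -
  define x y where "x = \<tau> / 2" and "y = \<alpha> / 2"
  have "cos (2 * x) - cos (2 * (x - y)) - (1 - cos (2 * y)) = - 4 * cos (x - y) * sin x * sin y"
    using sin_cos_squared_add[of x] sin_cos_squared_add[of y]
    unfolding cos_double_sin cos_diff sin_diff by algebra
  then show ?thesis by (simp add: x_def y_def diff_divide_distrib right_diff_distrib)
qed

lemma normal_angle_inside_nonneg:
  fixes \<alpha> \<tau> :: real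
  assumes "0 < \<alpha>" "\<alpha> < pi" "0 \<le> \<tau>" "\<tau> \<le> pi"
  shows "cos \<tau> - cos (\<tau> - \<alpha>) \<le> 1 - cos \<alpha>"
proof -
  have "0 \<le> cos ((\<tau> - \<alpha>) / 2) * sin (\<tau> / 2) * sin (\<alpha> / 2)"
    by (intro mult_nonneg_nonneg cos_ge_zero sin_ge_zero) (use assms in auto)
  with cos_diff_half_angle[of \<tau> \<alpha>] show ?thesis by linarith
qed

text \<open>Tilting the outer normal towards one of the two other points moves the touching disc
  away from it, so that point is not strictly inside. Reflection exchanges \<alpha> and \<beta> when
  \<tau> is negative.\<close>

lemma normal_angle_inside:
  fixes \<alpha> \<beta> \<tau> :: real
  assumes "0 < \<alpha>" "\<alpha> < pi" "0 < \<beta>" "\<beta> < pi" "- pi \<le> \<tau>" "\<tau> \<le> pi"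
  shows "cos \<tau> - cos (\<tau> - \<alpha>) \<le> 1 - cos \<alpha> \<or> cos \<tau> - cos (\<tau> + \<beta>) \<le> 1 - cos \<beta>"
proof (cases "\<tau> \<ge> 0")
  case False
  then show ?thesis
    using normal_angle_inside_nonneg[of \<beta> "- \<tau>"] assms cos_minus[of "\<tau> + \<beta>"] by simp
qed (use assms normal_angle_inside_nonneg in blast)

text \<open>The hypothesis \<open>le\<close> puts the point at angle \<alpha> on the inner side of
  the tangent line, which bounds the tilt by \<open>\<alpha> / 2\<close>. Then \<open>(\<tau> +
  \<beta>) / 2 \<le> (\<alpha> + 2 * \<beta>) / 4 \<le> pi / 2\<close>, so the cosine factor is
  nonnegative and the point at angle \<open>- \<beta>\<close> lies in the closed touching
  disc.\<close>

lemma normal_angle_outside_nonneg: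
  fixes \<alpha> \<beta> \<tau> :: real
  assumes "0 < \<alpha>" "0 < \<beta>" "\<alpha> + 2 * \<beta> \<le> 2 * pi" "0 \<le> \<tau>" "\<tau> \<le> pi"
    and le: "cos (\<tau> - \<alpha>) \<le> cos \<tau>"
  shows "1 - cos \<beta> \<le> cos \<tau> - cos (\<tau> + \<beta>)"
proof -
  have "\<tau> \<le> \<alpha> / 2"
  proof (rule ccontr)
    assume "\<not> \<tau> \<le> \<alpha> / 2"
    then have "\<bar>\<tau> - \<alpha>\<bar> < \<tau>" using assms by linarith
    then have "cos \<tau> < cos \<bar>\<tau> - \<alpha>\<bar>" using assms by (intro cos_monotone_0_pi) auto
    with le show False by simp
  qed
  then have "0 \<le> cos ((\<tau> - - \<beta>) / 2) * sin (\<tau> / 2) * sin (\<beta> / 2)"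
    by (intro mult_nonneg_nonneg cos_ge_zero sin_ge_zero) (use assms in auto)
  with cos_diff_half_angle[of \<tau> "- \<beta>"] show ?thesis by simp
qed

lemma normal_angle_outside:
  fixes \<alpha> \<beta> \<tau> :: real
  assumes "0 < \<alpha>" "0 < \<beta>" "2 * \<alpha> + \<beta> \<le> 2 * pi" "\<alpha> + 2 * \<beta> \<le> 2 * pi" "- pi \<le> \<tau>" "\<tau> \<le> pi"
    and "cos (\<tau> - \<alpha>) \<le> cos \<tau>" "cos (\<tau> + \<beta>) \<le> cos \<tau>"
  shows "1 - cos \<alpha> \<le> cos \<tau> - cos (\<tau> - \<alpha>) \<or> 1 - cos \<beta> \<le> cos \<tau> - cos (\<tau> + \<beta>)"
proof (cases "\<tau> \<ge> 0")
  case False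
  then show ?thesis
    using normal_angle_outside_nonneg[of \<beta> \<alpha> "- \<tau>"] assms cos_minus[of "\<tau> + \<beta>"] cos_minus[of "\<tau> - \<alpha>"]
    by simp
qed (use assms normal_angle_outside_nonneg in blast)

section \<open>Three points on a circle\<close>

text \<open>The two inequalities say that the third arc \<open>2 * pi - \<alpha> - \<beta>\<close>
  is at least as long as each of \<alpha> and \<beta>.\<close>

lemma vertex_opposite_longest_arc:
  assumes "S \<subseteq> sphere z R" "card S = 3"
  obtains \<phi> \<alpha> \<beta> where "0 < \<alpha>" "0 < \<beta>" "2 * \<alpha> + \<beta> \<le> 2 * pi" "\<alpha> + 2 * \<beta> \<le> 2 * pi"
    "z + of_real R * cis \<phi> \<in> S" "z + of_real R * cis (\<phi> + \<alpha>) \<in> S"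
    "z + of_real R * cis (\<phi> - \<beta>) \<in> S"
proof -
  define A where "A = {\<theta>. 0 \<le> \<theta> \<and> \<theta> < 2 * pi \<and> z + of_real R * cis \<theta> \<in> S}"
  have angle: "\<exists>\<theta>\<in>A. x = z + of_real R * cis \<theta>" if "x \<in> S" for x
  proof -
    have "x - z = of_real R * cis (Arg2pi (x - z))"
      using that assms(1) Arg2pi_eq[of "x - z"]
      by (auto simp: dist_norm norm_minus_commute cis_conv_exp subset_iff)
    then show ?thesis using that Arg2pi[of "x - z"]
      by (intro bexI[of _ "Arg2pi (x - z)"]) (auto simp: A_def algebra_simps)
  qed
  obtain a b c where abc: "a \<in> S" "b \<in> S" "c \<in> S" "a \<noteq> b" "b \<noteq> c" "a \<noteq> c"
    using assms(2) by (auto simp: card_3_iff)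
  from angle[OF abc(1)] angle[OF abc(2)] angle[OF abc(3)] abc(4-6)
  obtain t1 t2 t3 where t: "t1 \<in> A" "t2 \<in> A" "t3 \<in> A" "t1 \<noteq> t2" "t2 \<noteq> t3" "t1 \<noteq> t3"
    by metis
  obtain x y w where xyw: "x \<in> A" "y \<in> A" "w \<in> A" "x < y" "y < w"
    using t by (metis linorder_less_linear)
  have S: "z + of_real R * cis x \<in> S" "z + of_real R * cis y \<in> S" "z + of_real R * cis w \<in> S"
    and w: "w < 2 * pi" "0 \<le> x"
    using xyw by (auto simp: A_def)
  \<comment> \<open>The longest arc runs from \<open>y\<close> to \<open>w\<close>, from
    \<open>w\<close> through angle 0 to \<open>x\<close>, or from \<open>x\<close> to
    \<open>y\<close>; the vertex opposite to it is \<open>x\<close>, \<open>y\<close> or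
    \<open>w\<close> respectively.\<close>
  consider "y - x \<le> w - y" "2 * pi - w + x \<le> w - y"
    | "w - y \<le> 2 * pi - w + x" "y - x \<le> 2 * pi - w + x"
    | "2 * pi - w + x \<le> y - x" "w - y \<le> y - x"
    by linarith
  then show ?thesis
  proof cases
    case 1
    have "cis (x - (2 * pi - w + x)) = cis w" by (simp add: cis.ctr cos_diff sin_diff)
    with 1 show ?thesis
      using that[of "y - x" "2 * pi - w + x" x] S xyw w by simp
  next
    case 2
    then show ?thesis
      using that[of "w - y" "y - x" y] S xyw w by simp
  next
    case 3
    have "cis (w + (2 * pi - w + x)) = cis x" by (simp add: cis.ctr cos_add sin_add)
    with 3 show ?thesis
      using that[of "2 * pi - w + x" "w - y" w] S xyw w by simp
  qed
qed

section \<open>The moving frame and its derivative\<close>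

definition unit_tangent :: "(real \<Rightarrow> complex) \<Rightarrow> real \<Rightarrow> complex" where
  "unit_tangent \<gamma> t = sgn (vel \<gamma> t)"

text \<open>A left quarter turn of the tangent; positive curvature makes this the inner normal, as
  \<open>support\<close> shows.\<close>

definition unit_normal :: "(real \<Rightarrow> complex) \<Rightarrow> real \<Rightarrow> complex" where
  "unit_normal \<gamma> t = \<i> * unit_tangent \<gamma> t"

lemma inner_ii_left: "inner (\<i> * x) y = - inner x (\<i> * y)"
  by (simp add: inner_complex_def)

lemma inner_ii_ii [simp]: "inner (\<i> * x) (\<i> * y) = inner x y"
  by (simp add: inner_complex_def)

lemma inner_ii_self [simp]: "inner x (\<i> * x) = 0" "inner (\<i> * x) x = 0"
  by (simp_all add: inner_complex_def)

text \<open>In the plane, \<open>\<i> * u\<close> spans the orthogonal complement of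
  \<open>u\<close>. At critical points this turns a vanishing inner product into
  parallelism.\<close>

lemma orthogonal_unit_vector_complex:
  fixes a u :: complex
  assumes "inner a u = 0" "norm u = 1"
  shows "a = of_real (inner a (\<i> * u)) * (\<i> * u)"
proof -
  have u: "(Re u)\<^sup>2 + (Im u)\<^sup>2 = 1" using assms(2) by (simp add: cmod_def)
  have o: "Re a * Re u + Im a * Im u = 0" using assms(1) by (simp add: inner_complex_def)
  have "Re a = (Im a * Re u - Re a * Im u) * - Im u"
    using u o by algebra
  moreover have "Im a = (Im a * Re u - Re a * Im u) * Re u"
    using u o by algebra
  ultimately show ?thesis by (simp add: complex_eq_iff inner_complex_def)
qed

locale oval =
  fixes \<gamma> :: "real \<Rightarrow> complex" and L :: real
  assumes oval: "closed_convex_C2_curve \<gamma> L"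
begin

abbreviation "v \<equiv> vel \<gamma>"
abbreviation "\<kappa> \<equiv> curvature \<gamma>"
abbreviation "T \<equiv> unit_tangent \<gamma>"
abbreviation "N \<equiv> unit_normal \<gamma>"

lemma L_pos: "L > 0"
  and periodic: "\<gamma> (t + L) = \<gamma> t"
  and curvature_pos: "\<kappa> t > 0"
  and vel_nz: "v t \<noteq> 0"
  using oval by (auto simp: closed_convex_C2_curve_def simple_closed_def C2_regular_def)

lemma inj: "inj_on \<gamma> {0..<L}"
  using oval by (auto simp: closed_convex_C2_curve_def simple_closed_def)

lemma deriv_curve: "(\<gamma> has_vector_derivative v t) (at t)"
  using oval unfolding vel_def
  by (simp add: closed_convex_C2_curve_def C2_regular_def vector_derivative_works)

lemma deriv_vel: "(v has_vector_derivative acc \<gamma> t) (at t)"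
  using oval unfolding acc_def
  by (simp add: closed_convex_C2_curve_def C2_regular_def vector_derivative_works)

lemma vel_periodic: "v (t + L) = v t"
  using deriv_curve[of "t + L"] deriv_curve[of t]
  by (meson has_vector_derivative_periodic periodic vector_derivative_unique_at)

lemma acc_periodic: "acc \<gamma> (t + L) = acc \<gamma> t"
  using deriv_vel[of "t + L"] deriv_vel[of t]
  by (meson has_vector_derivative_periodic vel_periodic vector_derivative_unique_at)

lemma tangent_periodic: "T (t + L) = T t"
  by (simp add: unit_tangent_def vel_periodic)

lemma curvature_periodic: "\<kappa> (t + L) = \<kappa> t"
  by (simp add: curvature_def vel_periodic acc_periodic)

lemma norm_tangent [simp]: "norm (T t) = 1"
  by (simp add: unit_tangent_def norm_sgn vel_nz)

lemma norm_normal [simp]: "norm (N t) = 1"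
  by (simp add: unit_normal_def norm_mult)

lemma inner_tangent_self [simp]: "inner (T t) (T t) = 1"
  by (simp add: dot_square_norm)

lemma vel_eq: "v t = of_real (norm (v t)) * T t"
  by (simp add: unit_tangent_def sgn_div_norm scaleR_conv_of_real vel_nz)

text \<open>The Frenet equation at arbitrary speed. The real part of
  \<open>cnj (v t) * acc \<gamma> t\<close> is the tangential part of the acceleration, cancelled by
  the derivative of the speed; the imaginary part is the numerator of the curvature.\<close>

lemma deriv_tangent:
  "(T has_vector_derivative of_real (\<kappa> t * norm (v t)) * N t) (at t)"
proof -
  define D where "D = inner (v t) (acc \<gamma> t)"
  have nz: "norm (v t) \<noteq> 0" by (simp add: vel_nz)
  have "((\<lambda>x. inverse (norm (v x)) *\<^sub>R v x) has_vector_derivative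
      inverse (norm (v t)) *\<^sub>R acc \<gamma> t - (D / norm (v t) ^ 3) *\<^sub>R v t) (at t)"
    (is "(_ has_vector_derivative ?A) _")
  proof -
    have n: "((\<lambda>x. norm (v x)) has_real_derivative D / norm (v t)) (at t)"
    proof -
      have "((\<lambda>x. norm (v x)) has_derivative (\<lambda>h. inner (h *\<^sub>R acc \<gamma> t) (sgn (v t)))) (at t)"
        using deriv_vel[of t] unfolding has_vector_derivative_def
        by (rule has_derivative_compose) (rule has_derivative_norm[OF vel_nz])
      then show ?thesis
        unfolding has_field_derivative_def
        by (rule has_derivative_eq_rhs)
          (simp add: D_def sgn_div_norm inner_commute divide_inverse mult_ac fun_eq_iff)
    qed
    have "- (inverse (norm (v t)) * (D / norm (v t)) * inverse (norm (v t))) = - (D / norm (v t) ^ 3)"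
      by (simp add: divide_inverse power3_eq_cube mult_ac)
    with has_vector_derivative_scaleR[OF DERIV_inverse'[OF n nz] deriv_vel[of t]]
    show ?thesis by (simp only: scaleR_minus_left add_uminus_conv_diff)
  qed
  moreover have "?A = of_real (\<kappa> t * norm (v t)) * N t"
  proof -
    have "cnj (v t) * acc \<gamma> t = of_real D + \<i> * of_real (Im (cnj (v t) * acc \<gamma> t))"
      by (simp add: complex_eq_iff D_def inner_complex_def)
    then have "v t * cnj (v t) * acc \<gamma> t = v t * (of_real D + \<i> * of_real (Im (cnj (v t) * acc \<gamma> t)))"
      by (simp only: mult.assoc)
    moreover have "(of_real (norm (v t)))\<^sup>2 = v t * cnj (v t)"
      using complex_norm_square[of "v t"] by simp
    ultimately have *: "(of_real (norm (v t)))\<^sup>2 * acc \<gamma> t =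
        v t * (of_real D + \<i> * of_real (Im (cnj (v t) * acc \<gamma> t)))"
      by simp
    have "of_real (norm (v t)) ^ 3 * ?A =
        (of_real (norm (v t)))\<^sup>2 * acc \<gamma> t - of_real D * v t"
      using nz by (simp add: scaleR_conv_of_real field_simps power3_eq_cube power2_eq_square)
    also have "\<dots> = \<i> * v t * of_real (Im (cnj (v t) * acc \<gamma> t))"
      unfolding * by (simp add: algebra_simps)
    also have "\<dots> = of_real (norm (v t)) ^ 3 * (of_real (\<kappa> t * norm (v t)) * N t)"
      using nz by (simp add: curvature_def unit_normal_def unit_tangent_def sgn_div_norm
          scaleR_conv_of_real field_simps)
    finally show ?thesis using nz by simp
  qed
  moreover have "T = (\<lambda>x. inverse (norm (v x)) *\<^sub>R v x)"
    by (simp add: fun_eq_iff unit_tangent_def sgn_div_norm)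
  ultimately show ?thesis by simp
qed

lemma inner_vel: "inner (v t) a = norm (v t) * inner (T t) a"
  by (subst vel_eq) (simp add: inner_complex_def algebra_simps)

lemma deriv_inner_curve:
  "((\<lambda>x. inner (\<gamma> x) a) has_real_derivative norm (v t) * inner (T t) a) (at t)"
  using has_real_derivative_inner_left[OF deriv_curve[of t], of a] by (simp add: inner_vel)

lemma deriv_inner_tangent:
  "((\<lambda>x. inner (T x) a) has_real_derivative \<kappa> t * norm (v t) * inner (N t) a) (at t)"
proof -
  have "inner (of_real (\<kappa> t * norm (v t)) * N t) a = \<kappa> t * norm (v t) * inner (N t) a"
    by (simp add: inner_complex_def algebra_simps)
  then show ?thesis using has_real_derivative_inner_left[OF deriv_tangent[of t], of a] by metis
qed

lemma continuous_curvature: "continuous_on UNIV \<kappa>"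
proof -
  have "continuous_on UNIV v"
    by (intro continuous_at_imp_continuous_on ballI has_vector_derivative_continuous[OF deriv_vel])
  moreover have "continuous_on UNIV (acc \<gamma>)"
    using oval by (simp add: closed_convex_C2_curve_def C2_regular_def)
  ultimately show ?thesis
    unfolding curvature_def by (intro continuous_intros) (auto simp: vel_nz)
qed

section \<open>Supporting lines and touching discs\<close>

text \<open>A supporting line of the convex body at \<open>\<gamma> s\<close> is tangent there, so
  its normal is a multiple of \<open>N s\<close>. Positive curvature fixes the sign of the
  multiple.\<close>

lemma support: "inner (N s) (\<gamma> t - \<gamma> s) \<ge> 0"
proof -
  obtain K where K: "compact K" "convex K" "frontier K = \<gamma> ` {0..L}" "interior K \<noteq> {}"
    using oval by (auto simp: closed_convex_C2_curve_def convex_curve_def)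
  have range: "\<gamma> t \<in> frontier K" for t
    using periodic_reduce[of L \<gamma> t] L_pos periodic K(3) by (metis image_eqI)
  have "closed K" using K(1) by (rule compact_imp_closed)
  \<comment> \<open>Since the interior is nonempty, frontier points lie outside the relative
    interior and admit a supporting line.\<close>
  obtain a where a: "a \<noteq> 0" "\<And>x. x \<in> K \<Longrightarrow> inner a (\<gamma> s) \<le> inner a x"
    using supporting_hyperplane_relative_frontier[of K "\<gamma> s"] K(2,4) range[of s] \<open>closed K\<close>
    by (metis DiffD1 DiffD2 closure_closed frontier_def rel_interior_nonempty_interior)
  have min: "inner (\<gamma> s) a \<le> inner (\<gamma> t) a" for t
    using a(2) range[of t] K(1) by (metis compact_imp_closed frontier_subset_closed inner_commute subsetD)
  have "norm (v s) * inner (T s) a = 0"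
    by (rule DERIV_local_min[OF deriv_inner_curve, of 1]) (use min in auto)
  then have T0: "inner (T s) a = 0" by (simp add: vel_nz)
  define \<mu> where "\<mu> = inner a (N s)"
  have a_eq: "a = of_real \<mu> * N s"
    unfolding \<mu>_def unit_normal_def
    by (rule orthogonal_unit_vector_complex) (use T0 in \<open>simp_all add: inner_commute\<close>)
  \<comment> \<open>For negative \<mu>, the height \<open>inner (\<gamma> x) a\<close> would be
    strictly concave to second order at \<open>s\<close> and drop below its minimum.\<close>
  have "\<not> \<mu> < 0"
  proof
    assume "\<mu> < 0"
    then have "\<kappa> s * norm (v s) * inner (N s) a < 0"
      using curvature_pos[of s] vel_nz[of s]
      by (intro mult_pos_neg mult_pos_pos) (auto simp: \<mu>_def inner_commute)
    from decrease_right_of_critical_point[OF deriv_inner_curve _ T0 deriv_inner_tangent this]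
    obtain x where "inner (\<gamma> x) a < inner (\<gamma> s) a" using vel_nz by auto
    with min[of x] show False by simp
  qed
  moreover have "\<mu> \<noteq> 0" using a_eq a(1) by auto
  ultimately have "\<mu> > 0" by simp
  have "\<mu> * inner (N s) (\<gamma> t - \<gamma> s) = inner a (\<gamma> t - \<gamma> s)"
    by (subst a_eq) (simp add: inner_complex_def algebra_simps)
  also have "\<dots> \<ge> 0" using min[of t] by (simp add: inner_diff_right inner_commute)
  finally show ?thesis using \<open>\<mu> > 0\<close> by (simp add: zero_le_mult_iff)
qed

text \<open>The sign \<sigma> treats \<open>R * \<kappa> < 1\<close> and
  \<open>R * \<kappa> > 1\<close> at once: the scaled expression is minimal where the tangents
  agree, and its value there is 0.\<close>

lemma support_tangent_disc:
  assumes "\<And>s. \<sigma> * (1 - R * \<kappa> s) > 0"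
  shows "\<sigma> * (inner (\<gamma> s - \<gamma> t) (N t) + R * inner (T s) (T t) - R) \<ge> 0"
proof -
  define f where "f s = \<sigma> * (inner (\<gamma> s - \<gamma> t) (N t) + R * inner (T s) (T t) - R)" for s
  define k where "k s = \<sigma> * (1 - R * \<kappa> s) * norm (v s)" for s
  have k: "k s > 0" for s using assms vel_nz by (simp add: k_def)
  have NT: "inner (N s) (T t) = - inner (T s) (N t)" for s
    by (simp add: unit_normal_def inner_ii_left)
  have f': "(f has_real_derivative k s * inner (T s) (N t)) (at s)" for s
  proof -
    have f_eq: "f = (\<lambda>s. \<sigma> * (inner (\<gamma> s) (N t) + R * inner (T s) (T t)) -
        \<sigma> * (inner (\<gamma> t) (N t) + R))"
      by (simp add: f_def fun_eq_iff inner_diff_left algebra_simps)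
    have "(f has_real_derivative \<sigma> * (norm (v s) * inner (T s) (N t) +
        R * (\<kappa> s * norm (v s) * inner (N s) (T t))) - 0) (at s)"
      unfolding f_eq
      by (intro DERIV_diff DERIV_cmult DERIV_add DERIV_const deriv_inner_curve deriv_inner_tangent)
    then show ?thesis by (simp add: k_def NT algebra_simps)
  qed
  have "continuous_on UNIV f"
    by (intro continuous_at_imp_continuous_on ballI DERIV_isCont[OF f'])
  moreover have "f (s + L) = f s" for s by (simp add: f_def periodic tangent_periodic)
  ultimately obtain s0 where min: "\<And>s. f s0 \<le> f s"
    using periodic_continuous_attains_min[of f L] L_pos by blast
  have "k s0 * inner (T s0) (N t) = 0"
    by (rule DERIV_local_min[OF f', of 1]) (use min in auto)
  then have 0: "inner (T s0) (N t) = 0" using k[of s0] by simp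
  define e where "e = inner (T s0) (T t)"
  have T_eq: "T s0 = of_real e * T t"
  proof -
    \<comment> \<open>Here \<open>\<i> * N t = - T t\<close>, and the two minus signs
      cancel.\<close>
    have "T s0 = of_real (inner (T s0) (\<i> * N t)) * (\<i> * N t)"
      by (rule orthogonal_unit_vector_complex) (use 0 in simp_all)
    then show ?thesis by (simp add: e_def unit_normal_def flip: mult.assoc)
  qed
  have "norm (T s0) = \<bar>e\<bar>" by (subst T_eq) (simp add: norm_mult)
  then have "\<bar>e\<bar> = 1" by simp
  \<comment> \<open>At opposite tangents, \<open>inner (T s) (N t)\<close> decreases through 0, so
    \<open>s0\<close> could not be a minimum.\<close>
  have "\<not> e < 0"
  proof
    assume "e < 0"
    moreover have "inner (N s0) (N t) = e" by (simp add: unit_normal_def e_def)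
    ultimately have "\<kappa> s0 * norm (v s0) * inner (N s0) (N t) < 0"
      using curvature_pos[of s0] vel_nz[of s0] by (intro mult_pos_neg mult_pos_pos) auto
    from decrease_right_of_critical_point[OF f' k 0 deriv_inner_tangent this] min
    show False by (meson not_le)
  qed
  with \<open>\<bar>e\<bar> = 1\<close> have "e = 1" by simp
  with T_eq have N_eq: "N s0 = N t" by (simp add: unit_normal_def)
  \<comment> \<open>With equal inner normals, each point lies on the inner side of the other's
    tangent line, so the two lines coincide.\<close>
  have "inner (\<gamma> s0 - \<gamma> t) (N t) = 0"
    using support[of t s0] support[of s0 t] unfolding N_eq
    by (simp add: inner_diff_left inner_diff_right inner_commute)
  with \<open>e = 1\<close> have "f s0 = 0" by (simp add: f_def e_def)
  with min[of s] show ?thesis unfolding f_def by linarith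
qed

text \<open>Comparing with \<open>R\<close> squared, the sign of the first two terms on the right
  tells whether \<open>\<gamma> t\<close> is inside or outside the disc of radius \<open>R\<close>
  touching at \<open>\<gamma> s\<close>. The inequalities below are stated through these
  terms.\<close>

lemma norm_tangent_disc_center:
  "(norm (\<gamma> t - (\<gamma> s + of_real R * N s)))\<^sup>2 =
     (norm (\<gamma> t - \<gamma> s))\<^sup>2 - 2 * R * inner (N s) (\<gamma> t - \<gamma> s) + R\<^sup>2"
proof -
  have 1: "inner (N s) (N s) = 1" by (simp add: dot_square_norm)
  have "\<gamma> t - (\<gamma> s + of_real R * N s) = (\<gamma> t - \<gamma> s) - R *\<^sub>R N s"
    by (simp add: scaleR_conv_of_real)
  moreover have "inner (x - R *\<^sub>R N s) (x - R *\<^sub>R N s) = inner x x - 2 * R * inner (N s) x + R\<^sup>2" for x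
    by (simp add: inner_diff 1 inner_commute[of x "N s"] power2_eq_square right_diff_distrib)
  ultimately show ?thesis
    by (simp only: power2_norm_eq_inner)
qed

lemma inner_normal_center:
  "inner (\<gamma> s + of_real R * N s - \<gamma> t) (N t) = inner (\<gamma> s - \<gamma> t) (N t) + R * inner (T s) (T t)"
proof -
  have "\<gamma> s + of_real R * N s - \<gamma> t = (\<gamma> s - \<gamma> t) + R *\<^sub>R N s"
    by (simp add: scaleR_conv_of_real)
  moreover have "inner (N s) (N t) = inner (T s) (T t)" by (simp add: unit_normal_def)
  ultimately show ?thesis by (simp only: inner_add_left inner_scaleR_left)
qed

text \<open>The centre has distance at least \<open>R\<close> from the tangent line at
  \<open>t\<close>, hence from \<open>\<gamma> t\<close> on that line.\<close>

lemma outside_tangent_disc: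
  assumes "R > 0" "\<And>s. R * \<kappa> s < 1"
  shows "2 * R * inner (N s) (\<gamma> t - \<gamma> s) \<le> (norm (\<gamma> t - \<gamma> s))\<^sup>2"
proof -
  let ?c = "\<gamma> s + of_real R * N s"
  have "R \<le> inner (?c - \<gamma> t) (N t)"
    using support_tangent_disc[of 1 R s t] assms(2) unfolding inner_normal_center by simp
  also have "\<dots> \<le> norm (\<gamma> t - ?c)"
    using norm_cauchy_schwarz[of "?c - \<gamma> t" "N t"] by (simp add: norm_minus_commute)
  finally have "R\<^sup>2 \<le> (norm (\<gamma> t - ?c))\<^sup>2" using assms(1) by (intro power_mono) auto
  then show ?thesis by (simp add: norm_tangent_disc_center)
qed

text \<open>Distance to a tangent line does not bound distance to its contact point from above,
  except where the centre lies on the normal. This happens at the curve point farthest from the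
  centre, and bounding that one distance suffices.\<close>

lemma inside_tangent_disc:
  assumes "R > 0" "\<And>s. R * \<kappa> s > 1"
  shows "(norm (\<gamma> t - \<gamma> s))\<^sup>2 \<le> 2 * R * inner (N s) (\<gamma> t - \<gamma> s)"
proof -
  define c where "c = \<gamma> s + of_real R * N s"
  \<comment> \<open>The minus sign makes the minimum of \<open>f\<close> the farthest point.\<close>
  define f where "f t = - ((norm (\<gamma> t - c))\<^sup>2)" for t
  have f': "(f has_real_derivative - 2 * norm (v t) * inner (T t) (\<gamma> t - c)) (at t)" for t
  proof -
    have "((\<lambda>x. \<gamma> x - c) has_derivative (\<lambda>h. h *\<^sub>R v t)) (at t)"
      using deriv_curve[of t] by (auto simp: has_vector_derivative_def intro!: derivative_eq_intros)
    from has_derivative_inner[OF this this]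
    have "((\<lambda>x. inner (\<gamma> x - c) (\<gamma> x - c)) has_derivative
        (\<lambda>h. (2 * norm (v t) * inner (T t) (\<gamma> t - c)) * h)) (at t)"
      by (rule has_derivative_eq_rhs)
        (simp add: fun_eq_iff inner_commute[of "\<gamma> t - c" "v t"] inner_vel)
    then have "((\<lambda>x. inner (\<gamma> x - c) (\<gamma> x - c)) has_real_derivative
        2 * norm (v t) * inner (T t) (\<gamma> t - c)) (at t)"
      by (simp add: has_field_derivative_def)
    moreover have "f = (\<lambda>x. - inner (\<gamma> x - c) (\<gamma> x - c))"
      by (simp add: f_def power2_norm_eq_inner fun_eq_iff)
    ultimately show ?thesis by (auto intro: derivative_eq_intros)
  qed
  have "continuous_on UNIV f"
    by (intro continuous_at_imp_continuous_on ballI DERIV_isCont[OF f'])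
  moreover have "f (s + L) = f s" for s by (simp add: f_def periodic)
  ultimately obtain t0 where min: "\<And>t. f t0 \<le> f t"
    using periodic_continuous_attains_min[of f L] L_pos by blast
  have "- 2 * norm (v t0) * inner (T t0) (\<gamma> t0 - c) = 0"
    by (rule DERIV_local_min[OF f', of 1]) (use min in auto)
  then have 0: "inner (\<gamma> t0 - c) (T t0) = 0" by (simp add: vel_nz inner_commute)
  define m where "m = inner (\<gamma> t0 - c) (N t0)"
  have m: "\<gamma> t0 - c = of_real m * N t0"
    unfolding m_def unit_normal_def by (rule orthogonal_unit_vector_complex) (use 0 in simp_all)
  have norm_m: "norm (\<gamma> t0 - c) = \<bar>m\<bar>" unfolding m by (simp add: norm_mult)
  have "- m \<le> R"
    using support_tangent_disc[of "-1" R s t0] assms(2) inner_normal_center[of s R t0]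
    by (simp add: m_def c_def inner_diff_left)
  moreover have "m \<le> 0"
  proof (rule ccontr)
    \<comment> \<open>Then \<open>c\<close> is on the outer side of the tangent line at
      \<open>t0\<close>, where \<open>\<gamma> t0\<close> is also the curve point nearest to
      \<open>c\<close>. Being farthest as well, it would be the only point of the curve.\<close>
    assume "\<not> m \<le> 0"
    have "\<gamma> x = \<gamma> t0" for x
    proof -
      have "c = \<gamma> t0 + of_real (- m) * N t0"
        using m by (simp add: algebra_simps)
      then have "(norm (\<gamma> x - c))\<^sup>2 =
          (norm (\<gamma> x - \<gamma> t0))\<^sup>2 + 2 * m * inner (N t0) (\<gamma> x - \<gamma> t0) + m\<^sup>2"
        using norm_tangent_disc_center[of x t0 "- m"] by simp
      moreover have "(norm (\<gamma> x - c))\<^sup>2 \<le> m\<^sup>2"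
        using min[of x] norm_m by (simp add: f_def)
      moreover have "2 * m * inner (N t0) (\<gamma> x - \<gamma> t0) \<ge> 0"
        using support[of t0 x] \<open>\<not> m \<le> 0\<close> by simp
      ultimately have "(norm (\<gamma> x - \<gamma> t0))\<^sup>2 \<le> 0" by linarith
      then show ?thesis by simp
    qed
    then have "\<gamma> 0 = \<gamma> (L/2)" by metis
    then show False using inj L_pos by (auto dest: inj_onD[where x = 0 and y = "L/2"])
  qed
  ultimately have "(norm (\<gamma> t0 - c))\<^sup>2 \<le> R\<^sup>2" unfolding norm_m by (intro power_mono) auto
  with min[of t] have "(norm (\<gamma> t - c))\<^sup>2 \<le> R\<^sup>2" unfolding f_def by linarith
  then show ?thesis unfolding c_def norm_tangent_disc_center by simp
qed

section \<open>Strict inequalities by compactness\<close>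

text \<open>The bounds are attained, so strict inequalities satisfied by every value of the
  curvature pass to them.\<close>

lemma curvature_bounds:
  obtains m M where "\<And>t. m \<le> \<kappa> t" "\<And>t. \<kappa> t \<le> M" "m \<in> range \<kappa>" "M \<in> range \<kappa>"
proof -
  obtain s where "\<And>t. \<kappa> s \<le> \<kappa> t"
    using periodic_continuous_attains_min[of \<kappa> L] continuous_curvature L_pos curvature_periodic
    by auto
  moreover obtain s' where "\<And>t. - \<kappa> s' \<le> - \<kappa> t"
    using periodic_continuous_attains_min[of "\<lambda>t. - \<kappa> t" L] L_pos curvature_periodic
      continuous_on_minus[OF continuous_curvature]
    by auto
  ultimately show ?thesis using that[of "\<kappa> s" "\<kappa> s'"] by auto
qed

text \<open>The maximal curvature leaves room for a slightly larger radius \<open>1/r\<close>. The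
  larger touching disc contains the smaller one except for the contact point in its
  interior.\<close>

lemma strictly_outside_tangent_disc:
  assumes "R > 0" "\<And>s. R * \<kappa> s < 1" "\<gamma> s \<noteq> \<gamma> t"
  shows "2 * R * inner (N s) (\<gamma> t - \<gamma> s) < (norm (\<gamma> t - \<gamma> s))\<^sup>2"
proof -
  obtain M where M: "\<And>t. \<kappa> t \<le> M" "M \<in> range \<kappa>" using curvature_bounds by metis
  have "M > 0" "M < 1/R" using M(2) curvature_pos assms(1,2) by (auto simp: field_simps)
  then obtain r where r: "M < r" "r < 1/R" using dense by blast
  have "2 * (1/r) * inner (N s) (\<gamma> t - \<gamma> s) \<le> (norm (\<gamma> t - \<gamma> s))\<^sup>2"
    by (rule outside_tangent_disc) (use r M(1) \<open>M > 0\<close> in \<open>auto simp: field_simps intro: le_less_trans\<close>)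
  moreover have "R < 1/r" using r \<open>M > 0\<close> assms(1) by (simp add: field_simps)
  moreover have "(norm (\<gamma> t - \<gamma> s))\<^sup>2 > 0" using assms(3) by simp
  ultimately show ?thesis using support[of s t]
    by (smt (verit) mult_le_0_iff mult_less_cancel_right mult_right_mono)
qed

lemma strictly_inside_tangent_disc:
  assumes "R > 0" "\<And>s. R * \<kappa> s > 1" "\<gamma> s \<noteq> \<gamma> t"
  shows "(norm (\<gamma> t - \<gamma> s))\<^sup>2 < 2 * R * inner (N s) (\<gamma> t - \<gamma> s)"
proof -
  obtain m where m: "\<And>t. m \<le> \<kappa> t" "m \<in> range \<kappa>" using curvature_bounds by metis
  have "1/R < m" using m(2) assms(1,2) by (auto simp: field_simps)
  then obtain r where r: "1/R < r" "r < m" using dense by blast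
  have "r > 0" using r assms(1) by (smt (verit) divide_pos_pos)
  have "(norm (\<gamma> t - \<gamma> s))\<^sup>2 \<le> 2 * (1/r) * inner (N s) (\<gamma> t - \<gamma> s)"
    by (rule inside_tangent_disc) (use r m(1) \<open>r > 0\<close> in \<open>auto simp: field_simps intro: less_le_trans\<close>)
  moreover have "1/r < R" using r \<open>r > 0\<close> assms(1) by (simp add: field_simps)
  moreover have "(norm (\<gamma> t - \<gamma> s))\<^sup>2 > 0" using assms(3) by simp
  ultimately show ?thesis using support[of s t]
    by (smt (verit) mult_le_0_iff mult_less_cancel_right mult_right_mono)
qed

text \<open>A sufficiently large touching disc contains the curve, and it meets its tangent line
  only at the contact point.\<close>

lemma strict_support:
  assumes "\<gamma> s \<noteq> \<gamma> t"
  shows "inner (N s) (\<gamma> t - \<gamma> s) > 0"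
proof -
  obtain m where m: "\<And>t. m \<le> \<kappa> t" "m \<in> range \<kappa>" using curvature_bounds by metis
  have "m > 0" using m(2) curvature_pos by auto
  \<comment> \<open>The radius \<open>2/m\<close> is twice the largest radius of curvature, so its
    product with the curvature is at least 2.\<close>
  have "(norm (\<gamma> t - \<gamma> s))\<^sup>2 < 2 * (2/m) * inner (N s) (\<gamma> t - \<gamma> s)"
  proof (rule strictly_inside_tangent_disc)
    show "1 < 2/m * \<kappa> s" for s using m(1)[of s] \<open>m > 0\<close> by (simp add: field_simps)
  qed (use \<open>m > 0\<close> assms in auto)
  then have "0 < 2 * (2/m) * inner (N s) (\<gamma> t - \<gamma> s)"
    by (smt (verit) zero_le_power2)
  then show ?thesis using \<open>m > 0\<close> by (simp add: zero_less_divide_iff zero_less_mult_iff)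
qed

section \<open>Three points of the curve and the circle through them\<close>

text \<open>Of three collinear points one is between the others, but its tangent line has both
  others strictly on the same side.\<close>

lemma not_collinear:
  assumes "\<gamma> p \<noteq> \<gamma> q" "\<gamma> q \<noteq> \<gamma> r" "\<gamma> r \<noteq> \<gamma> p"
  shows "\<not> collinear {\<gamma> p, \<gamma> q, \<gamma> r}"
proof -
  have "\<not> between (\<gamma> x, \<gamma> y) (\<gamma> z)" if "\<gamma> z \<noteq> \<gamma> x" "\<gamma> z \<noteq> \<gamma> y" for x y z
  proof
    assume "between (\<gamma> x, \<gamma> y) (\<gamma> z)"
    then obtain u where u: "0 \<le> u" "u \<le> 1" "\<gamma> z = (1 - u) *\<^sub>R \<gamma> x + u *\<^sub>R \<gamma> y"
      by (auto simp: between_mem_segment in_segment)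
    have "(1 - u) *\<^sub>R (\<gamma> x - \<gamma> z) + u *\<^sub>R (\<gamma> y - \<gamma> z) =
        ((1 - u) *\<^sub>R \<gamma> x + u *\<^sub>R \<gamma> y) - \<gamma> z"
      by (simp add: algebra_simps)
    also have "\<dots> = 0" using u(3) by simp
    finally have "(1 - u) * inner (N z) (\<gamma> x - \<gamma> z) + u * inner (N z) (\<gamma> y - \<gamma> z) = 0"
      by (metis inner_add_right inner_scaleR_right inner_zero_right)
    moreover have "inner (N z) (\<gamma> x - \<gamma> z) > 0" "inner (N z) (\<gamma> y - \<gamma> z) > 0"
      using that strict_support by auto
    ultimately show False
      using u(1,2) by (smt (verit) mult_nonneg_nonneg mult_pos_pos)
  qed
  then show ?thesis using assms collinear_between_cases by metis
qed

lemma curvature_of_circle_through_three_points: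
  assumes S: "S \<subseteq> range \<gamma>" "S \<subseteq> sphere z R" "card S = 3" and "R > 0"
  shows "\<exists>t. \<kappa> t = 1 / R"
proof (rule ccontr)
  assume no: "\<nexists>t. \<kappa> t = 1 / R"
  obtain \<phi> \<alpha> \<beta> where ang: "0 < \<alpha>" "0 < \<beta>" "2 * \<alpha> + \<beta> \<le> 2 * pi" "\<alpha> + 2 * \<beta> \<le> 2 * pi"
    and inS: "z + of_real R * cis \<phi> \<in> S" "z + of_real R * cis (\<phi> + \<alpha>) \<in> S"
      "z + of_real R * cis (\<phi> - \<beta>) \<in> S"
    using vertex_opposite_longest_arc[OF S(2,3)] by blast
  from inS S(1) obtain p a c where pts: "\<gamma> p = z + of_real R * cis \<phi>"
      "\<gamma> a = z + of_real R * cis (\<phi> + \<alpha>)" "\<gamma> c = z + of_real R * cis (\<phi> + - \<beta>)"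
    by (auto simp: image_iff subset_iff) metis
  \<comment> \<open>The angle from the radius direction \<open>cis \<phi>\<close> to the outer
    normal \<open>- N p\<close>.\<close>
  define \<tau> where "\<tau> = Arg (- N p * cis (- \<phi>))"
  have \<tau>: "- pi \<le> \<tau>" "\<tau> \<le> pi" unfolding \<tau>_def using Arg_bounded by (auto simp: less_imp_le)
  have "cis \<tau> = - N p * cis (- \<phi>)"
  proof -
    have 1: "norm (- N p * cis (- \<phi>)) = 1" by (simp add: norm_mult)
    then have "- N p * cis (- \<phi>) \<noteq> 0" by (metis norm_zero zero_neq_one)
    then have "cis \<tau> = sgn (- N p * cis (- \<phi>))" unfolding \<tau>_def by (rule cis_Arg)
    with 1 show ?thesis by (simp only: sgn_div_norm) simp
  qed
  then have "cis \<phi> * cis \<tau> = - N p * (cis (- \<phi>) * cis \<phi>)" by (simp add: mult_ac)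
  then have Np: "N p = - cis (\<phi> + \<tau>)" by (simp add: cis_mult)
  have inner_q: "inner (N p) (\<gamma> q - \<gamma> p) = R * (cos \<tau> - cos (\<tau> - \<delta>))"
    and norm_q: "(norm (\<gamma> q - \<gamma> p))\<^sup>2 = 2 * R\<^sup>2 * (1 - cos \<delta>)"
    if "\<gamma> q = z + of_real R * cis (\<phi> + \<delta>)" for q \<delta>
  proof -
    have d: "\<gamma> q - \<gamma> p = of_real R * (cis (\<phi> + \<delta>) - cis \<phi>)"
      by (simp add: that pts(1) algebra_simps)
    have "inner (cis x) (cis y) = cos (x - y)" for x y
      by (simp add: inner_complex_def cos_diff)
    note c = this
    have "inner (N p) (\<gamma> q - \<gamma> p) = R * (inner (cis (\<phi> + \<tau>)) (cis \<phi>) - inner (cis (\<phi> + \<tau>)) (cis (\<phi> + \<delta>)))"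
      unfolding d Np by (simp add: inner_complex_def algebra_simps)
    then show "inner (N p) (\<gamma> q - \<gamma> p) = R * (cos \<tau> - cos (\<tau> - \<delta>))"
      by (simp add: c)
    have "(norm (cis (\<phi> + \<delta>) - cis \<phi>))\<^sup>2 = 2 * (1 - cos \<delta>)"
      unfolding power2_norm_eq_inner by (simp add: inner_diff c)
    then show "(norm (\<gamma> q - \<gamma> p))\<^sup>2 = 2 * R\<^sup>2 * (1 - cos \<delta>)"
      unfolding d by (simp add: norm_mult power_mult_distrib)
  qed
  \<comment> \<open>Neither arc is the longest of the three, and all are positive, so both are
    shorter than a half circle.\<close>
  have lt_pi: "\<alpha> < pi" "\<beta> < pi" using ang by linarith+
  then have "cos \<alpha> < 1" "cos \<beta> < 1"
    using ang(1,2) cos_monotone_0_pi[of 0 \<alpha>] cos_monotone_0_pi[of 0 \<beta>] by simp_all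
  with norm_q[OF pts(2)] norm_q[OF pts(3)] \<open>R > 0\<close> have ne: "\<gamma> p \<noteq> \<gamma> a" "\<gamma> p \<noteq> \<gamma> c"
    by auto
  have R2: "2 * R * (R * x) = 2 * R\<^sup>2 * x" for x by (simp add: power2_eq_square)
  have "2 * R\<^sup>2 > 0" using \<open>R > 0\<close> by simp
  \<comment> \<open>By the intermediate value property, curvature avoiding \<open>1 / R\<close>
    stays on one side of it.\<close>
  have "is_interval (range \<kappa>)"
    using connected_continuous_image[OF continuous_curvature connected_UNIV]
    by (simp add: is_interval_connected_1)
  then have "(\<forall>t. \<kappa> t < 1 / R) \<or> (\<forall>t. \<kappa> t > 1 / R)"
    using no by (smt (verit) mem_is_interval_1_I rangeE rangeI)
  then show False
  proof
    assume "\<forall>t. \<kappa> t < 1 / R"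
    then have "\<And>t. R * \<kappa> t < 1" using \<open>R > 0\<close> by (simp add: field_simps)
    from strictly_outside_tangent_disc[OF \<open>R > 0\<close> this ne(1)]
      strictly_outside_tangent_disc[OF \<open>R > 0\<close> this ne(2)]
    have "cos \<tau> - cos (\<tau> - \<alpha>) < 1 - cos \<alpha>" "cos \<tau> - cos (\<tau> + \<beta>) < 1 - cos \<beta>"
      unfolding inner_q[OF pts(2)] norm_q[OF pts(2)] inner_q[OF pts(3)] norm_q[OF pts(3)] R2
      using \<open>2 * R\<^sup>2 > 0\<close> by (simp_all add: mult_less_cancel_left_pos)
    \<comment> \<open>Being outside the touching disc does not yet contradict the position of the
      points; the tangent line must also have both on its inner side.\<close>
    moreover have "cos (\<tau> - \<alpha>) \<le> cos \<tau>" "cos (\<tau> + \<beta>) \<le> cos \<tau>"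
      using support[of p a] support[of p c] \<open>R > 0\<close>
      unfolding inner_q[OF pts(2)] inner_q[OF pts(3)] by (simp_all add: zero_le_mult_iff)
    ultimately show False
      using normal_angle_outside[of \<alpha> \<beta> \<tau>] ang \<tau> by linarith
  next
    assume "\<forall>t. \<kappa> t > 1 / R"
    then have "\<And>t. R * \<kappa> t > 1" using \<open>R > 0\<close> by (simp add: field_simps)
    from strictly_inside_tangent_disc[OF \<open>R > 0\<close> this ne(1)]
      strictly_inside_tangent_disc[OF \<open>R > 0\<close> this ne(2)]
    have "cos \<tau> - cos (\<tau> - \<alpha>) > 1 - cos \<alpha>" "cos \<tau> - cos (\<tau> + \<beta>) > 1 - cos \<beta>"
      unfolding inner_q[OF pts(2)] norm_q[OF pts(2)] inner_q[OF pts(3)] norm_q[OF pts(3)] R2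
      using \<open>2 * R\<^sup>2 > 0\<close> by (simp_all add: mult_less_cancel_left_pos)
    then show False
      using normal_angle_inside[of \<alpha> \<beta> \<tau>] ang lt_pi \<tau> by linarith
  qed
qed

end

section \<open>The circumcircle and the common curvature value\<close>

lemma circumcircle_exists:
  fixes a b c :: complex
  assumes "\<not> collinear {a, b, c}"
  obtains z R where "R > 0" "{a, b, c} \<subseteq> sphere z R"
proof -
  define p q d where "p = b - a" and "q = c - a" and "d = Re p * Im q - Im p * Re q"
  have ne: "\<not> collinear {0, p, q}"
    using assms collinear_3[of b a c] by (simp add: p_def q_def insert_commute)
  then have "q / p \<notin> \<real>" by (simp add: collinear_iff_Reals)
  then have "d \<noteq> 0"
    by (auto simp: complex_is_Real_iff Im_divide d_def mult.commute)
  \<comment> \<open>The circumcentre relative to \<open>a\<close>: Cramer's rule for the linear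
    system \<open>2 * inner w p = (norm p)\<^sup>2\<close>,
    \<open>2 * inner w q = (norm q)\<^sup>2\<close>, whose determinant is a multiple of
    \<open>d\<close>.\<close>
  define w where "w = Complex (((norm p)\<^sup>2 * Im q - (norm q)\<^sup>2 * Im p) / (2 * d))
    (((norm q)\<^sup>2 * Re p - (norm p)\<^sup>2 * Re q) / (2 * d))"
  have "2 * d * Re w = (norm p)\<^sup>2 * Im q - (norm q)\<^sup>2 * Im p"
    "2 * d * Im w = (norm q)\<^sup>2 * Re p - (norm p)\<^sup>2 * Re q"
    using \<open>d \<noteq> 0\<close> by (simp_all add: w_def)
  then have "d * (2 * (Re w * Re p + Im w * Im p)) = d * (norm p)\<^sup>2"
    "d * (2 * (Re w * Re q + Im w * Im q)) = d * (norm q)\<^sup>2"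
    unfolding d_def by algebra+
  then have "2 * inner w p = (norm p)\<^sup>2" "2 * inner w q = (norm q)\<^sup>2"
    using \<open>d \<noteq> 0\<close> by (simp_all add: inner_complex_def)
  then have "(norm (w - p))\<^sup>2 = (norm w)\<^sup>2" "(norm (w - q))\<^sup>2 = (norm w)\<^sup>2"
    unfolding power2_norm_eq_inner by (simp_all add: inner_diff inner_commute)
  then have eq: "norm (w - p) = norm w" "norm (w - q) = norm w" by simp_all
  have "w \<noteq> 0"
  proof
    assume "w = 0"
    with eq have "p = 0" by simp
    with \<open>d \<noteq> 0\<close> show False by (simp add: d_def)
  qed
  moreover have "{a, b, c} \<subseteq> sphere (a + w) (norm w)"
    using eq by (auto simp: dist_norm p_def q_def algebra_simps)
  ultimately show ?thesis using that[of "norm w" "a + w"] by simp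
qed

theorem theorem4p6:
  fixes \<gamma>1 \<gamma>2 :: "real \<Rightarrow> complex" and L1 L2 :: real
  assumes "closed_convex_C2_curve \<gamma>1 L1"
      and "closed_convex_C2_curve \<gamma>2 L2"
      and "\<exists>S. S \<subseteq> \<gamma>1 ` {0..L1} \<inter> \<gamma>2 ` {0..L2} \<and> finite S \<and> card S \<ge> 3"
  shows "\<exists>s t. curvature \<gamma>1 s = curvature \<gamma>2 t"
proof -
  interpret c1: oval \<gamma>1 L1 by unfold_locales fact
  interpret c2: oval \<gamma>2 L2 by unfold_locales fact
  obtain S' where S': "S' \<subseteq> \<gamma>1 ` {0..L1} \<inter> \<gamma>2 ` {0..L2}" "3 \<le> card S'"
    using assms(3) by blast
  obtain S where "S \<subseteq> S'" "card S = 3"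
    using obtain_subset_with_card_n[OF S'(2)] by blast
  with S'(1) have S: "S \<subseteq> range \<gamma>1" "S \<subseteq> range \<gamma>2" "card S = 3" by auto
  then obtain a b c where abc: "S = {a, b, c}" "a \<noteq> b" "b \<noteq> c" "a \<noteq> c"
    by (auto simp: card_3_iff)
  with S(1) obtain p q r where "a = \<gamma>1 p" "b = \<gamma>1 q" "c = \<gamma>1 r" by auto
  with abc c1.not_collinear[of p q r] have "\<not> collinear {a, b, c}" by auto
  then obtain z R where "R > 0" "S \<subseteq> sphere z R"
    unfolding abc(1) by (rule circumcircle_exists)
  \<comment> \<open>Both curves pass through the same three points, so one circle supplies the value
    \<open>1 / R\<close> for both.\<close>
  with S obtain s t where "curvature \<gamma>1 s = 1 / R" "curvature \<gamma>2 t = 1 / R"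
    using c1.curvature_of_circle_through_three_points[of S z R]
      c2.curvature_of_circle_through_three_points[of S z R] by blast
  then show ?thesis by metis
qed

end
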